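(* Let $(X,S)$ be an $S$-metric space and let $\mathcal{I}$ be an admissible ideal of $\mathbb{N}$. If $\{x_n\}_{n\in\mathbb{N}}$ is an $\mathcal{I}$-Cauchy sequence in $X$, then it is $\mathcal{I}$-localized everywhere.
   Context: An $S$-metric on a nonempty set $X$ is a function $S:X\times X\times X\to[0,\infty)$ such that for all $x,y,z,a\in X$: (i) $S(x,y,z)\ge 0$; (ii) $S(x,y,z)=0$ if and only if $x=y=z$; (iii) $S(x,y,z)\le S(x,x,a)+S(y,y,a)+S(z,z,a)$. The pair $(X,S)$ is called an $S$-metric space. An ideal $\mathcal{I}$ of $\mathbb{N}$ is a collection of subsets of $\mathbb{N}$ closed under finite unions and under taking subsets; it is non-trivial if it is neither $\{\emptyset\}$ nor $2^{\mathbb{N}}$, and admissible if it is non-trivial and $\{n\}\in\mathcal{I}$ for every $n\in\mathbb{N}$. A sequence $\{x_n\}$ in $X$ is $\mathcal{I}$-Cauchy if for every $\varepsilon>0$ there is a positive integer $n_0=n_0(\varepsilon)$ such that $\{n\in\mathbb{N}:S(x_n,x_n,x_{n_0})\ge\varepsilon\}\in\mathcal{I}$. A real sequence $\{a_n\}_{n\in\mathbb{N}}$ is $\mathcal{I}$-convergent to $a\in\mathbb{R}$ if $\{n\in\mathbb{N}:|a_n-a|\ge\varepsilon\}\in\mathcal{I}$ for every $\varepsilon>0$. A sequence $\{x_n\}$ in $X$ is $\mathcal{I}$-localized in $M\subset X$ if for each $x\in M$ the real sequence $\{S(x_n,x_n,x)\}_{n\in\mathbb{N}}$ is $\mathcal{I}$-convergent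 (to some real number). The $\mathcal{I}$-locator of $\{x_n\}$ is the maximal subset of $X$ on which $\{x_n\}$ is $\mathcal{I}$-localized, and $\{x_n\}$ is $\mathcal{I}$-localized everywhere if its $\mathcal{I}$-locator is the whole set $X$. *)

theory Defs
  imports Complex_Main
begin

locale S_metric_space =
  fixes X :: "'a set" and S :: "'a \<Rightarrow> 'a \<Rightarrow> 'a \<Rightarrow> real"
  assumes carrier_nonempty: "X \<noteq> {}"
    and nonneg: "\<lbrakk>x \<in> X; y \<in> X; z \<in> X\<rbrakk> \<Longrightarrow> 0 \<le> S x y z"
    and zero_iff: "\<lbrakk>x \<in> X; y \<in> X; z \<in> X\<rbrakk> \<Longrightarrow> S x y z = 0 \<longleftrightarrow> x = y \<and> y = z"
    and triangle: "\<lbrakk>x \<in> X; y \<in> X; z \<in> X; a \<in> X\<rbrakk>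
      \<Longrightarrow> S x y z \<le> S x x a + S y y a + S z z a"

text \<open>The empty family is a finite family, so every ideal contains the empty set.\<close>

definition is_ideal :: "nat set set \<Rightarrow> bool" where
  "is_ideal I \<longleftrightarrow>
    (\<forall>F. finite F \<and> F \<subseteq> I \<longrightarrow> \<Union>F \<in> I) \<and> (\<forall>A\<in>I. \<forall>B. B \<subseteq> A \<longrightarrow> B \<in> I)"

definition nontrivial_ideal :: "nat set set \<Rightarrow> bool" where
  "nontrivial_ideal I \<longleftrightarrow> is_ideal I \<and> I \<noteq> {{}} \<and> I \<noteq> UNIV"

definition admissible_ideal :: "nat set set \<Rightarrow> bool" where
  "admissible_ideal I \<longleftrightarrow> nontrivial_ideal I \<and> (\<forall>n. {n} \<in> I)"

text \<open>Sequences are indexed by all of \<^typ>\<open>nat\<close>, whereas the index \<open>n0\<close> is required to be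
  positive. Sequences indexed from 1 are covered too: choose the term at 0 arbitrarily and
  extend the ideal by the sets \<open>insert 0 A\<close>.\<close>

definition I_Cauchy :: "('a \<Rightarrow> 'a \<Rightarrow> 'a \<Rightarrow> real) \<Rightarrow> nat set set \<Rightarrow> (nat \<Rightarrow> 'a) \<Rightarrow> bool" where
  "I_Cauchy S I x \<longleftrightarrow> (\<forall>\<epsilon>>0. \<exists>n0>0. {n. S (x n) (x n) (x n0) \<ge> \<epsilon>} \<in> I)"

definition I_converges_to :: "nat set set \<Rightarrow> (nat \<Rightarrow> real) \<Rightarrow> real \<Rightarrow> bool" where
  "I_converges_to I a l \<longleftrightarrow> (\<forall>\<epsilon>>0. {n. \<bar>a n - l\<bar> \<ge> \<epsilon>} \<in> I)"

definition I_localized_in ::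
  "'a set \<Rightarrow> ('a \<Rightarrow> 'a \<Rightarrow> 'a \<Rightarrow> real) \<Rightarrow> nat set set \<Rightarrow> (nat \<Rightarrow> 'a) \<Rightarrow> 'a set \<Rightarrow> bool" where
  "I_localized_in X S I x M \<longleftrightarrow>
    M \<subseteq> X \<and> (\<forall>y\<in>M. \<exists>l. I_converges_to I (\<lambda>n. S (x n) (x n) y) l)"

text \<open>\<^const>\<open>Greatest\<close> is taken with respect to inclusion; the lemma after the definition
  shows that the greatest such set always exists.\<close>

definition I_locator ::
  "'a set \<Rightarrow> ('a \<Rightarrow> 'a \<Rightarrow> 'a \<Rightarrow> real) \<Rightarrow> nat set set \<Rightarrow> (nat \<Rightarrow> 'a) \<Rightarrow> 'a set" where
  "I_locator X S I x = (GREATEST M. I_localized_in X S I x M)"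

lemma I_locator_eq:
  "I_locator X S I x = {y \<in> X. \<exists>l. I_converges_to I (\<lambda>n. S (x n) (x n) y) l}"
  unfolding I_locator_def
  by (rule Greatest_equality) (auto simp: I_localized_in_def)

definition I_localized_everywhere ::
  "'a set \<Rightarrow> ('a \<Rightarrow> 'a \<Rightarrow> 'a \<Rightarrow> real) \<Rightarrow> nat set set \<Rightarrow> (nat \<Rightarrow> 'a) \<Rightarrow> bool" where
  "I_localized_everywhere X S I x \<longleftrightarrow> I_locator X S I x = X"

end

theory Submission imports Defs begin

text \<open>The map \<open>z \<mapsto> S(z, z, y)\<close> varies by at most \<open>2 S(z, z, w)\<close> between \<open>z\<close> and \<open>w\<close>, so an
  \<open>I\<close>-Cauchy sequence in \<open>X\<close> is mapped to a real \<open>I\<close>-Cauchy sequence. The latter converges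
  along \<open>I\<close> to its \<open>I\<close>-limit inferior \<open>Sup {t. {n. a n < t} \<in> I}\<close>.\<close>

lemma is_ideal_Un:
  assumes "is_ideal I" "A \<in> I" "B \<in> I"
  shows "A \<union> B \<in> I"
proof -
  have "finite F \<and> F \<subseteq> I \<longrightarrow> \<Union>F \<in> I" for F
    using assms(1) by (simp add: is_ideal_def)
  from this[of "{A, B}"] show ?thesis
    using assms(2,3) by simp
qed

lemma is_ideal_subset:
  assumes "is_ideal I" "A \<in> I" "B \<subseteq> A"
  shows "B \<in> I"
  using assms unfolding is_ideal_def by blast

text \<open>Downward closure: an ideal containing \<open>UNIV\<close> would contain every set of
  indices.\<close>

lemma nontrivial_ideal_UNIV:
  assumes "nontrivial_ideal I"
  shows "UNIV \<notin> I"
  using assms is_ideal_subset[of I UNIV] by (auto simp: nontrivial_ideal_def)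

text \<open>The centre \<open>c\<close> may depend on \<epsilon> and need not be a term of the
  sequence. Completeness of the reals supplies the limit as a supremum.\<close>

lemma real_I_Cauchy_imp_I_convergent:
  fixes a :: "nat \<Rightarrow> real"
  assumes I: "nontrivial_ideal I"
    and cauchy: "\<And>\<epsilon>. \<epsilon> > 0 \<Longrightarrow> \<exists>c. {n. \<bar>a n - c\<bar> \<ge> \<epsilon>} \<in> I"
  shows "\<exists>l. I_converges_to I a l"
proof -
  define T where "T = {t. {n. a n < t} \<in> I}"
  have ideal: "is_ideal I"
    using I by (simp add: nontrivial_ideal_def)
  \<comment> \<open>Every \<open>n\<close> with \<open>a n < c - \<epsilon>\<close> lies in the
    exceptional set of \<open>c\<close>. In particular \<open>T\<close> is nonempty.\<close>
  have lower: "c - \<epsilon> \<in> T" if c: "{n. \<bar>a n - c\<bar> \<ge> \<epsilon>} \<in> I" for c \<epsilon>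
    unfolding T_def mem_Collect_eq by (rule is_ideal_subset[OF ideal c]) auto
  \<comment> \<open>If \<open>t > c + \<epsilon>\<close>, each \<open>n\<close> has
    \<open>a n < t\<close> or lies at distance at least \<epsilon> from \<open>c\<close>, so two
    sets of the ideal would cover all indices. Hence \<open>T\<close> is bounded above.\<close>
  have upper: "t \<le> c + \<epsilon>" if c: "{n. \<bar>a n - c\<bar> \<ge> \<epsilon>} \<in> I" and t: "t \<in> T" for c \<epsilon> t
  proof (rule ccontr)
    assume "\<not> t \<le> c + \<epsilon>"
    then have "{n. a n < t} \<union> {n. \<bar>a n - c\<bar> \<ge> \<epsilon>} = UNIV"
      by auto
    moreover have "{n. a n < t} \<union> {n. \<bar>a n - c\<bar> \<ge> \<epsilon>} \<in> I"
      using t c by (intro is_ideal_Un[OF ideal]) (auto simp: T_def)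
    ultimately show False
      using nontrivial_ideal_UNIV[OF I] by simp
  qed
  have near: "\<bar>c - Sup T\<bar> \<le> \<epsilon>" if c: "{n. \<bar>a n - c\<bar> \<ge> \<epsilon>} \<in> I" for c \<epsilon>
  proof -
    have "c - \<epsilon> \<le> Sup T"
      using lower[OF c] bdd_aboveI[of T, OF upper[OF c]] by (rule cSup_upper)
    moreover have "Sup T \<le> c + \<epsilon>"
      using lower[OF c] by (intro cSup_least upper[OF c]) auto
    ultimately show ?thesis by linarith
  qed
  have "{n. \<bar>a n - Sup T\<bar> \<ge> \<epsilon>} \<in> I" if "\<epsilon> > 0" for \<epsilon>
  proof -
    obtain c where c: "{n. \<bar>a n - c\<bar> \<ge> \<epsilon> / 2} \<in> I"
      using cauchy[of "\<epsilon> / 2"] \<open>\<epsilon> > 0\<close> by auto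
    \<comment> \<open>The centre \<open>c\<close> is itself within \<open>\<epsilon> / 2\<close> of
      \<open>Sup T\<close>, which leaves the other half for \<open>a n\<close>.\<close>
    have "\<epsilon> / 2 \<le> \<bar>a n - c\<bar>" if "\<epsilon> \<le> \<bar>a n - Sup T\<bar>" for n
      using near[OF c] that by linarith
    then show ?thesis
      by (intro is_ideal_subset[OF ideal c]) auto
  qed
  then show ?thesis
    unfolding I_converges_to_def by blast
qed

context S_metric_space
begin

text \<open>Taking the auxiliary point of \<open>triangle\<close> to be the repeated point makes two
  of the three summands vanish.\<close>

lemma S_sym:
  assumes "x \<in> X" "y \<in> X"
  shows "S x x y = S y y x"
proof (rule antisym)
  show "S x x y \<le> S y y x"
    using triangle[of x x y x] zero_iff[of x x x] assms by simp
  show "S y y x \<le> S x x y"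
    using triangle[of y y x y] zero_iff[of y y y] assms by simp
qed

text \<open>The factor 2 arises because \<open>triangle\<close> counts the repeated first point
  twice; \<open>S_sym\<close> aligns the remaining terms.\<close>

lemma abs_S_diff_le:
  assumes "x \<in> X" "y \<in> X" "z \<in> X"
  shows "\<bar>S x x z - S y y z\<bar> \<le> 2 * S x x y"
proof -
  have "S x x z \<le> S x x y + S x x y + S z z y" "S y y z \<le> S y y x + S y y x + S z z x"
    by (rule triangle; fact)+
  moreover have "S y y x = S x x y" "S z z x = S x x z" "S z z y = S y y z"
    by (rule S_sym; fact)+
  ultimately show ?thesis by linarith
qed

end

theorem lemma3p2:
  fixes X :: "'a set" and S :: "'a \<Rightarrow> 'a \<Rightarrow> 'a \<Rightarrow> real"
    and I :: "nat set set" and x :: "nat \<Rightarrow> 'a"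
  assumes "S_metric_space X S"
    and "admissible_ideal I"
    and "\<And>n. x n \<in> X"
    and "I_Cauchy S I x"
  shows "I_localized_everywhere X S I x"
proof -
  interpret S_metric_space X S by fact
  have I: "nontrivial_ideal I"
    using assms(2) by (simp add: admissible_ideal_def)
  then have ideal: "is_ideal I"
    by (simp add: nontrivial_ideal_def)
  have "\<exists>l. I_converges_to I (\<lambda>n. S (x n) (x n) y) l" if "y \<in> X" for y
  proof (rule real_I_Cauchy_imp_I_convergent[OF I])
    fix \<epsilon> :: real
    assume "\<epsilon> > 0"
    then have "\<epsilon> / 2 > 0"
      by simp
    then obtain m where m: "{n. S (x n) (x n) (x m) \<ge> \<epsilon> / 2} \<in> I"
      using assms(4) unfolding I_Cauchy_def by blast
    \<comment> \<open>The centre is the value at the Cauchy index \<open>m\<close>; the threshold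
      \<open>\<epsilon> / 2\<close> absorbs the factor 2 of \<open>abs_S_diff_le\<close>.\<close>
    have "{n. \<bar>S (x n) (x n) y - S (x m) (x m) y\<bar> \<ge> \<epsilon>} \<subseteq> {n. S (x n) (x n) (x m) \<ge> \<epsilon> / 2}"
    proof safe
      fix n
      assume "\<epsilon> \<le> \<bar>S (x n) (x n) y - S (x m) (x m) y\<bar>"
      then show "\<epsilon> / 2 \<le> S (x n) (x n) (x m)"
        using abs_S_diff_le[OF assms(3) assms(3) \<open>y \<in> X\<close>, of n m] by linarith
    qed
    then show "\<exists>c. {n. \<bar>S (x n) (x n) y - c\<bar> \<ge> \<epsilon>} \<in> I"
      using is_ideal_subset[OF ideal m] by blast
  qed
  then show ?thesis
    by (auto simp: I_localized_everywhere_def I_locator_eq)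
qed

end
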